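(* Let $0<\nu<1$, $p\ge 2$, $\mathbf{F}_0=\mathbf{0}$, and suppose $\mathbf{X}_j^T\mathbf{y}\neq 0$ for some $j$. Suppose $L_2$Boosting with learning parameter $\nu$ is run until the end of its $M^*$-th descent, with critical directions $l_r$, descent lengths $L_r$ and critical points $S_r$, $r=1,\dots,M^*$. Then for $r=1,\dots,M^*$, $$\mathbf{F}_{S_r}=\mathbf{F}_{S_{r-1}}+\nu_{L_r}\,\rho^{(r)}_{l_r}\,\mathbf{X}_{l_r},\qquad \nu_m=1-(1-\nu)^m,$$ where $\{(l_r,L_r,S_r,\rho^{(r)}_{l_r})\}_{r=1}^{M^*}$ are determined recursively as follows. Start with $S_0=0$, $\rho^{(1)}_j=\mathbf{X}_j^T(\mathbf{y}-\mathbf{F}_0)$ and $l_1=\arg\max_{1\le j\le p}|\mathbf{X}_j^T(\mathbf{y}-\mathbf{F}_0)|$. Given $l_r$ and $(\rho^{(r)}_j)_{j}$, put for $j\ne l_r$ $$D^{(r)}_j=\frac{\rho^{(r)}_j}{\rho^{(r)}_{l_r}},\qquad M^{(r)}_j=\left\lfloor 1+\frac{\log|D^{(r)}_j-R_{j,l_r}|-\log\bigl(1-R_{j,l_r}\,\mathrm{sgn}(D^{(r)}_j-R_{j,l_r})\bigr)}{\log(1-\nu)}\right\rfloor ,$$ then $$L_r=M^{(r)}_{l_{r+1}},\qquad S_r=S_{r-1}+L_r,\qquad \rho^{(r+1)}_j=\mathbf{X}_j^T(\mathbf{y}-\mathbf{F}_{S_r})=\rho^{(r)}_j-\nu_{L_r}\rho^{(r)}_{l_r}R_{j,l_r},$$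 where $l_{r+1}$ is the coordinate maximizing $|\rho^{(r+1)}_j|$ among those $j\neq l_r$ that minimize $M^{(r)}_j$ (so that $L_r=\min_{j\ne l_r}M^{(r)}_j$); equivalently, $l_{r+1}=\arg\max_{j\ne l_r}|\rho^{(r+1)}_j|$.
   Context: $\mathbf{y}=(y_1,\dots,y_n)^T\in\mathbb{R}^n$ is a response vector and $\mathbf{X}=[\mathbf{X}_1,\dots,\mathbf{X}_p]$ is an $n\times p$ real design matrix with columns $\mathbf{X}_k=(x_{1,k},\dots,x_{n,k})^T$. The data are standardized: $\sum_i y_i=0$, $\sum_i x_{i,k}=0$ and $\sum_i x_{i,k}^2=1$ for each $k$. Put $R_{j,k}=\mathbf{X}_j^T\mathbf{X}_k$. $\lfloor z\rfloor$ is the largest integer $\le z$, $\mathrm{sgn}(0)=0$, and $M_j^{(r)}=\infty$ when $D_j^{(r)}=R_{j,l_r}$. $L_2$Boosting: starting from $\mathbf{F}_0=\mathbf{0}$, for $m=1,2,\dots$ set $k_m=\arg\max_{1\le k\le p}|\mathbf{X}_k^T(\mathbf{y}-\mathbf{F}_{m-1})|$ and $\mathbf{F}_m=\mathbf{F}_{m-1}+\nu\,\rho_m\mathbf{X}_{k_m}$ with $\rho_m=\mathbf{X}_{k_m}^T(\mathbf{y}-\mathbf{F}_{m-1})$. Ties: if the current direction $k_{m-1}$ attains the maximum at step $m$, then the descent continues along it ($k_m=k_{m-1}$), so a switch occurs only when another coordinate has strictly larger absolute gradient-correlation; ties among the other coordinates are broken by the same fixed rule (e.g. smallest index) in the algorithm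 and in the recursion. Critical directions, descent lengths, critical points: split the sequence $k_1,k_2,\dots$ into its maximal runs of consecutive equal values. The value of the $r$-th run is the critical direction $l_r$, its length is the descent length $L_r$, and $S_r=L_1+\dots+L_r$ (with $S_0=0$) is the critical point, i.e. the step number at which the descent along $l_r$ ends. It is assumed that the first $M^*$ descents all have finite length. *)

theory Defs
  imports "HOL-Analysis.Analysis"
begin

definition argmax_on :: "'a set \<Rightarrow> ('a \<Rightarrow> real) \<Rightarrow> 'a set" where
  "argmax_on A f = {x. is_arg_max f (\<lambda>x. x \<in> A) x}"

text \<open>
  The design matrix has rows indexed by \<open>'n\<close> (observations) and columns indexed by \<open>'p\<close>
  (covariates). The function \<open>sel\<close> is an arbitrary fixed rule for breaking ties: it is applied to
  the set of all tied coordinates. The step count starts at 1, so \<open>boost_dir sel \<nu> X y 0\<close> has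
  no meaning and is never used.
\<close>

function boost_fit ::
    "('p set \<Rightarrow> 'p) \<Rightarrow> real \<Rightarrow> real^'p^'n \<Rightarrow> real^'n \<Rightarrow> nat \<Rightarrow> real^'n"
  and boost_dir ::
    "('p set \<Rightarrow> 'p) \<Rightarrow> real \<Rightarrow> real^'p^'n \<Rightarrow> real^'n \<Rightarrow> nat \<Rightarrow> 'p"
where
  "boost_fit sel \<nu> X y 0 = 0"
| "boost_fit sel \<nu> X y (Suc m) =
    (let F = boost_fit sel \<nu> X y m;
         k = boost_dir sel \<nu> X y (Suc m);
         \<rho> = column k X \<bullet> (y - F)
     in F + (\<nu> * \<rho>) *\<^sub>R column k X)"
| "boost_dir sel \<nu> X y 0 = undefined"
| "boost_dir sel \<nu> X y (Suc m) =
    (let F = boost_fit sel \<nu> X y m;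
         A = argmax_on UNIV (\<lambda>k. \<bar>column k X \<bullet> (y - F)\<bar>);
         prev = boost_dir sel \<nu> X y m
     in if m \<noteq> 0 \<and> prev \<in> A then prev else sel A)"
  by pat_completeness auto
termination
  by (relation "Wellfounded.measure (\<lambda>x. case x of Inl (_, _, _, _, m) \<Rightarrow> 2 * m + 1
                                                 | Inr (_, _, _, _, m) \<Rightarrow> 2 * m)") auto

text \<open>
  Runs of a sequence \<open>k 1, k 2, \<dots>\<close>. If \<open>s = 0\<close> or \<open>k s \<noteq> k (s + 1)\<close>, then
  \<open>run_from k s\<close> is the set of positions of the maximal run of equal values that begins at
  position \<open>s + 1\<close>. In \<open>descent\<close>, \<open>crit_dir\<close> and \<open>descent_length\<close>, runs are
  numbered from 1. If the \<open>r\<close>-th run is infinite, then \<open>descent_length k r\<close> is the junk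
  value 0; the finiteness of \<open>descent k r\<close> has to be assumed separately.
\<close>

definition run_from :: "(nat \<Rightarrow> 'a) \<Rightarrow> nat \<Rightarrow> nat set" where
  "run_from k s = {m. s < m \<and> (\<forall>i\<in>{s<..m}. k i = k (Suc s))}"

fun crit_point :: "(nat \<Rightarrow> 'a) \<Rightarrow> nat \<Rightarrow> nat" where
  "crit_point k 0 = 0"
| "crit_point k (Suc r) = crit_point k r + card (run_from k (crit_point k r))"

definition descent :: "(nat \<Rightarrow> 'a) \<Rightarrow> nat \<Rightarrow> nat set" where
  "descent k r = run_from k (crit_point k (r - 1))"

definition descent_length :: "(nat \<Rightarrow> 'a) \<Rightarrow> nat \<Rightarrow> nat" where
  "descent_length k r = card (descent k r)"

definition crit_dir :: "(nat \<Rightarrow> 'a) \<Rightarrow> nat \<Rightarrow> 'a" where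
  "crit_dir k r = k (Suc (crit_point k (r - 1)))"

definition gram :: "real^'p^'n \<Rightarrow> 'p \<Rightarrow> 'p \<Rightarrow> real" where
  "gram X j k = column j X \<bullet> column k X"

definition acc_rate :: "real \<Rightarrow> nat \<Rightarrow> real" where
  "acc_rate \<nu> m = 1 - (1 - \<nu>) ^ m"

definition switch_time ::
    "real \<Rightarrow> real^'p^'n \<Rightarrow> 'p \<Rightarrow> ('p \<Rightarrow> real) \<Rightarrow> 'p \<Rightarrow> ereal" where
  "switch_time \<nu> X l \<rho> j =
    (let D = \<rho> j / \<rho> l; R = gram X j l
     in if D = R then \<infinity>
        else ereal (of_int \<lfloor>1 + (ln \<bar>D - R\<bar> - ln (1 - R * sgn (D - R))) / ln (1 - \<nu>)\<rfloor>))"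

text \<open>
  The recursion, run for \<open>N\<close> rounds; round \<open>r\<close> also yields \<open>l (r + 1)\<close> and
  \<open>\<rho> (r + 1)\<close>. It does not refer to the boosting iterates (\<open>\<rho> 1\<close> uses only the initial
  fit 0). The last two clauses force \<open>L r\<close> to be the minimal switch time, because
  \<open>l (r + 1)\<close> is chosen among the minimizers.
\<close>

definition critical_recursion ::
    "('p set \<Rightarrow> 'p) \<Rightarrow> real \<Rightarrow> real^'p^'n \<Rightarrow> real^'n \<Rightarrow> nat \<Rightarrow>
     (nat \<Rightarrow> 'p) \<Rightarrow> (nat \<Rightarrow> nat) \<Rightarrow> (nat \<Rightarrow> nat) \<Rightarrow> (nat \<Rightarrow> 'p \<Rightarrow> real) \<Rightarrow> bool" where
  "critical_recursion sel \<nu> X y N l L S \<rho> \<longleftrightarrow>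
     S 0 = 0 \<and>
     (\<forall>j. \<rho> 1 j = column j X \<bullet> (y - 0)) \<and>
     l 1 = sel (argmax_on UNIV (\<lambda>j. \<bar>\<rho> 1 j\<bar>)) \<and>
     (\<forall>r\<in>{1..N}.
        S r = S (r - 1) + L r \<and>
        (\<forall>j. \<rho> (r + 1) j = \<rho> r j - acc_rate \<nu> (L r) * \<rho> r (l r) * gram X j (l r)) \<and>
        ereal (real (L r)) = switch_time \<nu> X (l r) (\<rho> r) (l (r + 1)) \<and>
        l (r + 1) =
          sel (argmax_on {j. is_arg_min (switch_time \<nu> X (l r) (\<rho> r)) (\<lambda>j. j \<noteq> l r) j}
                         (\<lambda>j. \<bar>\<rho> (r + 1) j\<bar>)))"

end

theory Submission
  imports Defs
begin

text \<open>
  With \<open>q = 1 - \<nu>\<close>, after \<open>m\<close> steps along \<open>l\<close> the correlations with the residual are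
  \<open>\<rho> l * q ^ m\<close> for \<open>l\<close> itself and \<open>\<rho> j - (1 - q ^ m) * \<rho> l * R\<close> for \<open>j\<close>, so \<open>j\<close> has strictly
  overtaken \<open>l\<close> iff \<open>q ^ m < \<bar>(D - R) + q ^ m * R\<bar>\<close>. As \<open>\<bar>D\<bar> \<le> 1\<close> and \<open>\<bar>R\<bar> \<le> 1\<close>, only the
  side on which \<open>D - R\<close> lies matters, and the condition becomes
  \<open>q ^ m * (1 - R * sgn (D - R)) < \<bar>D - R\<bar>\<close>, which is monotone in \<open>m\<close>; taking logarithms, it
  holds exactly from \<open>m\<close> equal to the switch time of \<open>j\<close> on. A descent therefore lasts for the minimal
  switch time, and the coordinates having then overtaken \<open>l\<close> are exactly the minimizers, so that
  maximizing over them, over all coordinates, or over all coordinates except \<open>l\<close> is the same.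
\<close>

section \<open>Maximizers over sets of coordinates\<close>

lemma mem_argmax_on: "x \<in> argmax_on A f \<longleftrightarrow> x \<in> A \<and> (\<forall>z\<in>A. f z \<le> f x)"
  by (auto simp: argmax_on_def is_arg_max_def not_less)

lemma argmax_on_nonempty:
  assumes "finite A" "A \<noteq> {}"
  shows "argmax_on A f \<noteq> {}"
proof -
  have "Max (f ` A) \<in> f ` A"
    using assms by simp
  then obtain x where "x \<in> A" "f x = Max (f ` A)"
    by auto
  with assms have "x \<in> argmax_on A f"
    by (auto simp: mem_argmax_on)
  then show ?thesis
    by blast
qed

text \<open>Points outside \<open>B\<close> have value at most \<open>c\<close>, and some point
  exceeds \<open>c\<close>, so no point outside \<open>B\<close> can compete for the maximum. With
  \<open>c\<close> the absolute correlation of the direction just abandoned, this identifies the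
  sets of tied coordinates in the different descriptions of the next direction; as the sets are
  equal, an arbitrary \<open>sel\<close> makes the same choice from each.\<close>

lemma argmax_on_superlevel:
  assumes "\<And>j. c < f j \<Longrightarrow> j \<in> B" "c < f j"
  shows "argmax_on B f = argmax_on UNIV f"
proof (intro set_eqI iffI)
  fix x assume x: "x \<in> argmax_on B f"
  have "f z \<le> f x" for z
  proof (cases "z \<in> B")
    case True
    with x show ?thesis by (simp add: mem_argmax_on)
  next
    case False
    then have "f z \<le> c" using assms(1) by force
    also have "c < f j" by fact
    also have "f j \<le> f x" using x assms by (simp add: mem_argmax_on)
    finally show ?thesis by simp
  qed
  then show "x \<in> argmax_on UNIV f"
    by (simp add: mem_argmax_on)
next
  fix x assume x: "x \<in> argmax_on UNIV f"
  then have "c < f x"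
    using assms(2) by (meson UNIV_I less_le_trans mem_argmax_on)
  with x assms(1) show "x \<in> argmax_on B f"
    by (simp add: mem_argmax_on)
qed

section \<open>Maximal runs of a sequence\<close>

lemma mem_run_from:
  "m \<in> run_from k s \<longleftrightarrow> s < m \<and> (\<forall>i. s < i \<longrightarrow> i \<le> m \<longrightarrow> k i = k (Suc s))"
  unfolding run_from_def Ball_def mem_Collect_eq greaterThanAtMost_iff imp_conjL ..

lemma Suc_in_run_from: "Suc s \<in> run_from k s"
  by (metis mem_run_from lessI le_antisym Suc_leI)

text \<open>Above \<open>s\<close> a run is closed downwards, so a finite one fills everything up to
  its maximum, and its cardinality locates the position where it ends.\<close>

lemma run_from_eq:
  assumes "finite (run_from k s)"
  shows "run_from k s = {s<..s + card (run_from k s)}"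
proof -
  define t where "t = Max (run_from k s)"
  have t: "t \<in> run_from k s"
    unfolding t_def using assms Suc_in_run_from by (metis Max_in empty_iff)
  have "i \<in> run_from k s \<longleftrightarrow> i \<in> {s<..t}" for i
    using t Max_ge[OF assms, of i] unfolding t_def[symmetric] mem_run_from greaterThanAtMost_iff
    by (meson order_trans)
  then have eq: "run_from k s = {s<..t}"
    by blast
  moreover have "s < t"
    using t unfolding mem_run_from ..
  ultimately show ?thesis
    by simp
qed

lemma run_from_card:
  assumes "finite (run_from k s)"
  defines "n \<equiv> card (run_from k s)"
  shows "0 < n"
    and "\<And>i. s < i \<Longrightarrow> i \<le> s + n \<Longrightarrow> k i = k (Suc s)"
    and "k (Suc (s + n)) \<noteq> k (Suc s)"
proof -
  have eq: "i \<in> run_from k s \<longleftrightarrow> s < i \<and> i \<le> s + n" for i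
    using run_from_eq[OF assms(1)] unfolding n_def greaterThanAtMost_iff[symmetric] by (rule arg_cong)
  show "0 < n"
    using Suc_in_run_from[of s k] by (simp add: eq)
  show same: "k i = k (Suc s)" if "s < i" "i \<le> s + n" for i
    using eq[of i] that unfolding mem_run_from by blast
  show "k (Suc (s + n)) \<noteq> k (Suc s)"
  proof
    assume "k (Suc (s + n)) = k (Suc s)"
    with same have "\<forall>i. s < i \<longrightarrow> i \<le> Suc (s + n) \<longrightarrow> k i = k (Suc s)"
      by (metis le_Suc_eq)
    then have "Suc (s + n) \<in> run_from k s"
      unfolding mem_run_from by (metis le_add1 less_Suc_eq_le)
    then show False
      by (simp add: eq)
  qed
qed

section \<open>Switch times and strict overtaking\<close>

lemma overtake_iff_floor_le:
  fixes q D R :: real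
  assumes q: "0 < q" "q < 1" and D: "\<bar>D\<bar> \<le> 1" and R: "\<bar>R\<bar> \<le> 1" and ne: "D \<noteq> R"
  shows "q ^ m < \<bar>D - (1 - q ^ m) * R\<bar> \<longleftrightarrow>
    \<lfloor>1 + (ln \<bar>D - R\<bar> - ln (1 - R * sgn (D - R))) / ln q\<rfloor> \<le> int m"
proof -
  define d e where "d = \<bar>D - R\<bar>" and "e = 1 - R * sgn (D - R)"
  have d: "0 < d" using ne by (simp add: d_def)
  \<comment> \<open>If \<open>D < R\<close>, then \<open>e = 1 + R > 1 + D \<ge> 0\<close>; if
    \<open>D > R\<close>, then \<open>e = 1 - R > 1 - D \<ge> 0\<close>. So both logarithms have
    positive arguments.\<close>
  have e: "0 < e" using ne D by (cases "D < R") (auto simp: e_def sgn_if)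
  have qm: "0 < q ^ m" using q by simp
  define x where "x = q ^ m * R"
  have x: "\<bar>x\<bar> \<le> q ^ m"
    using mult_left_mono[OF R, of "q ^ m"] qm by (simp add: abs_mult x_def)
  have "D - (1 - q ^ m) * R = D - R + x" "q ^ m * e = q ^ m - x * sgn (D - R)"
    by (simp_all add: x_def e_def algebra_simps)
  \<comment> \<open>Because \<open>\<bar>x\<bar> \<le> q ^ m\<close>, the sum
    \<open>D - R + x\<close> can leave the interval from \<open>- (q ^ m)\<close> to
    \<open>q ^ m\<close> only in the direction of the sign of \<open>D - R\<close>; the other half
    of the absolute value drops out.\<close>
  then have "q ^ m < \<bar>D - (1 - q ^ m) * R\<bar> \<longleftrightarrow> q ^ m * e < d"
    using ne x by (cases "D < R") (auto simp: d_def)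
  also have "\<dots> \<longleftrightarrow> ln (q ^ m * e) < ln d"
    using d e qm by (subst ln_less_cancel_iff) auto
  also have "\<dots> \<longleftrightarrow> real m * ln q < ln d - ln e"
    using e q by (simp add: ln_mult ln_realpow less_diff_eq)
  also have "\<dots> \<longleftrightarrow> (ln d - ln e) / ln q < real m"
    using q by (simp add: neg_divide_less_eq)
  \<comment> \<open>The summand 1 under the floor encodes strictness: for real \<open>z\<close>,
    \<open>z < m\<close> holds iff \<open>\<lfloor>1 + z\<rfloor> \<le> m\<close>.\<close>
  also have "\<dots> \<longleftrightarrow> \<lfloor>1 + (ln d - ln e) / ln q\<rfloor> \<le> int m"
    by (simp only: floor_le_iff) simp
  finally show ?thesis
    by (simp add: d_def e_def)
qed

text \<open>The left side of the overtaking inequality is the absolute correlation of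
  \<open>l\<close> itself after \<open>m\<close> steps along \<open>l\<close>. Dividing both sides
  by \<open>\<bar>\<rho> l\<bar>\<close> gives the normalized inequality in \<open>D\<close> and
  \<open>R\<close>.\<close>

lemma switch_time_le_iff:
  assumes "0 < \<nu>" "\<nu> < 1" and "\<rho> l \<noteq> 0" "\<bar>\<rho> j\<bar> \<le> \<bar>\<rho> l\<bar>" "\<bar>gram X j l\<bar> \<le> 1"
  shows "switch_time \<nu> X l \<rho> j \<le> ereal (real m) \<longleftrightarrow>
    \<bar>\<rho> l\<bar> * (1 - \<nu>) ^ m < \<bar>\<rho> j - acc_rate \<nu> m * \<rho> l * gram X j l\<bar>"
proof -
  define D R q where "D = \<rho> j / \<rho> l" and "R = gram X j l" and "q = 1 - \<nu>"
  have q: "0 < q" "q < 1" using assms by (auto simp: q_def)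
  have "\<rho> j - acc_rate \<nu> m * \<rho> l * gram X j l = \<rho> l * (D - (1 - q ^ m) * R)"
    using assms(3) by (simp add: D_def R_def q_def acc_rate_def field_simps)
  then have "\<bar>\<rho> l\<bar> * q ^ m < \<bar>\<rho> j - acc_rate \<nu> m * \<rho> l * gram X j l\<bar> \<longleftrightarrow>
      q ^ m < \<bar>D - (1 - q ^ m) * R\<bar>"
    using assms(3) by (simp add: abs_mult)
  also have "\<dots> \<longleftrightarrow> switch_time \<nu> X l \<rho> j \<le> ereal (real m)"
  proof (cases "D = R")
    case True
    \<comment> \<open>Here the normalized correlation of \<open>j\<close> is
      \<open>q ^ m * R\<close>, which never exceeds \<open>q ^ m\<close> in absolute value, in
      agreement with the infinite switch time.\<close>
    have "D - (1 - q ^ m) * R = q ^ m * R"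
      using True by (simp add: algebra_simps)
    moreover have "\<bar>q ^ m * R\<bar> \<le> q ^ m"
      using mult_left_mono[of "\<bar>R\<bar>" 1 "q ^ m"] q assms(5) by (simp add: abs_mult R_def)
    moreover have "switch_time \<nu> X l \<rho> j = \<infinity>"
      using True by (simp add: switch_time_def D_def R_def)
    ultimately show ?thesis by simp
  next
    case False
    have "\<bar>D\<bar> \<le> 1" "\<bar>R\<bar> \<le> 1"
      using assms(3-5) by (auto simp: D_def R_def)
    from overtake_iff_floor_le[OF q this False] False show ?thesis
      unfolding switch_time_def Let_def D_def[symmetric] R_def[symmetric] q_def[symmetric]
      by simp linarith
  qed
  finally show ?thesis
    by (simp add: q_def)
qed

text \<open>A switch time is an integer or infinite, so none lies strictly between \<open>m\<close>
  and \<open>Suc m\<close>.\<close>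

lemma switch_time_eqI:
  assumes "switch_time \<nu> X l \<rho> j \<le> ereal (real (Suc m))"
    and "\<not> switch_time \<nu> X l \<rho> j \<le> ereal (real m)"
  shows "switch_time \<nu> X l \<rho> j = ereal (real (Suc m))"
proof (cases "\<rho> j / \<rho> l = gram X j l")
  case True
  with assms(1) show ?thesis by (simp add: switch_time_def)
next
  case False
  have "\<exists>z::int. switch_time \<nu> X l \<rho> j = ereal (of_int z)"
    unfolding switch_time_def Let_def if_not_P[OF False] by (rule exI, rule refl)
  then obtain z :: int where z: "switch_time \<nu> X l \<rho> j = ereal (of_int z)" ..
  with assms have "real_of_int z \<le> real (Suc m)" "real m < real_of_int z"
    by auto
  then have "z = int (Suc m)" by linarith
  then show ?thesis by (simp add: z)
qed

section \<open>Residual correlations along the boosting path\<close>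

locale l2_boosting =
  fixes X :: "real^'p^'n" and y :: "real^'n" and \<nu> :: real and sel :: "'p set \<Rightarrow> 'p"
  assumes nu: "0 < \<nu>" "\<nu> < 1"
    and unit_columns: "\<And>j. (\<Sum>i\<in>UNIV. (X $ i $ j)\<^sup>2) = 1"
    and correlated: "\<exists>j. column j X \<bullet> y \<noteq> 0"
    and sel: "\<And>A. A \<noteq> {} \<Longrightarrow> sel A \<in> A"
begin

abbreviation "F \<equiv> boost_fit sel \<nu> X y"
abbreviation "k \<equiv> boost_dir sel \<nu> X y"

definition corr :: "nat \<Rightarrow> 'p \<Rightarrow> real" where
  "corr m j = column j X \<bullet> (y - F m)"

lemma gram_self: "gram X j j = 1"
  using unit_columns[of j]
  by (simp add: gram_def inner_vec_def column_def power2_eq_square)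

lemma abs_gram_le_1: "\<bar>gram X j l\<bar> \<le> 1"
proof -
  have "norm (column i X) = 1" for i
    using gram_self[of i] by (simp add: gram_def norm_eq_1)
  then show ?thesis
    using Cauchy_Schwarz_ineq2[of "column j X" "column l X"] by (simp add: gram_def)
qed

lemma fit_Suc: "F (Suc m) = F m + (\<nu> * corr m (k (Suc m))) *\<^sub>R column (k (Suc m)) X"
  by (simp only: boost_fit.simps Let_def corr_def)

lemma dir_Suc:
  "k (Suc m) = (let A = argmax_on UNIV (\<lambda>j. \<bar>corr m j\<bar>)
     in if m \<noteq> 0 \<and> k m \<in> A then k m else sel A)"
  by (simp only: boost_dir.simps Let_def corr_def)

declare boost_fit.simps(2) [simp del] boost_dir.simps [simp del]

lemma dir_in_argmax: "k (Suc m) \<in> argmax_on UNIV (\<lambda>j. \<bar>corr m j\<bar>)"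
  using sel[OF argmax_on_nonempty[of UNIV "\<lambda>j. \<bar>corr m j\<bar>"]]
  by (auto simp: dir_Suc Let_def)

lemma abs_corr_le: "\<bar>corr m j\<bar> \<le> \<bar>corr m (k (Suc m))\<bar>"
  using dir_in_argmax[of m] by (simp add: mem_argmax_on)

lemma corr_add:
  assumes "F n = F m + c *\<^sub>R column l X"
  shows "corr n j = corr m j - c * gram X j l"
  by (simp add: assms corr_def gram_def algebra_simps)

text \<open>A step multiplies the selected correlation by \<open>1 - \<nu>\<close>, which is
  nonzero, so the correlations never all vanish and the largest one is a legitimate divisor in
  \<open>D\<close>.\<close>

lemma corr_dir_nonzero: "corr m (k (Suc m)) \<noteq> 0"
proof -
  have "\<exists>j. corr m j \<noteq> 0"
  proof (induction m)
    case 0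
    then show ?case using correlated by (simp add: corr_def)
  next
    case (Suc m)
    then have "corr m (k (Suc m)) \<noteq> 0"
      using abs_corr_le[of m] by (metis abs_le_zero_iff abs_zero)
    moreover have "corr (Suc m) (k (Suc m)) = (1 - \<nu>) * corr m (k (Suc m))"
      by (subst corr_add[OF fit_Suc]) (simp add: gram_self algebra_simps)
    ultimately show ?case
      using nu by (intro exI[of _ "k (Suc m)"]) simp
  qed
  then show ?thesis
    using abs_corr_le[of m] by (metis abs_le_zero_iff abs_zero)
qed

text \<open>The correlation of \<open>l\<close> decays geometrically along the run, so the
  increments \<open>\<nu> * (1 - \<nu>) ^ i\<close> for \<open>i < m\<close> add up to
  \<open>acc_rate \<nu> m\<close>.\<close>

lemma fit_along_run:
  assumes "\<And>i. s < i \<Longrightarrow> i \<le> s + m \<Longrightarrow> k i = l"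
  shows "F (s + m) = F s + (acc_rate \<nu> m * corr s l) *\<^sub>R column l X"
  using assms
proof (induction m)
  case 0
  then show ?case by (simp add: acc_rate_def)
next
  case (Suc m)
  then have IH: "F (s + m) = F s + (acc_rate \<nu> m * corr s l) *\<^sub>R column l X"
    by simp
  have "k (Suc (s + m)) = l"
    using Suc.prems by simp
  then have step: "F (s + Suc m) = F (s + m) + (\<nu> * corr (s + m) l) *\<^sub>R column l X"
    using fit_Suc[of "s + m"] by simp
  have corr: "corr (s + m) l = (1 - \<nu>) ^ m * corr s l"
    unfolding corr_add[OF IH] by (simp add: gram_self acc_rate_def algebra_simps)
  have rate: "acc_rate \<nu> (Suc m) = acc_rate \<nu> m + \<nu> * (1 - \<nu>) ^ m"
    by (simp add: acc_rate_def algebra_simps)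
  show ?case
    unfolding step IH corr rate by (simp add: algebra_simps)
qed

section \<open>One finite run, beginning after step \<open>s\<close>\<close>

context
  fixes s :: nat
  assumes finite_run: "finite (run_from k s)"
begin

definition "run_len = card (run_from k s)"
definition "run_dir = k (Suc s)"

lemma run_len_pos: "0 < run_len"
  unfolding run_len_def by (rule run_from_card(1)[OF finite_run])

lemma dir_in_run: "s < i \<Longrightarrow> i \<le> s + run_len \<Longrightarrow> k i = run_dir"
  unfolding run_len_def run_dir_def by (rule run_from_card(2)[OF finite_run])

lemma dir_after_run_neq: "k (Suc (s + run_len)) \<noteq> run_dir"
  unfolding run_len_def run_dir_def by (rule run_from_card(3)[OF finite_run])

lemma fit_in_run:
  "m \<le> run_len \<Longrightarrow> F (s + m) = F s + (acc_rate \<nu> m * corr s run_dir) *\<^sub>R column run_dir X"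
  by (rule fit_along_run, rule dir_in_run) auto

lemma corr_in_run:
  "m \<le> run_len \<Longrightarrow> corr (s + m) j = corr s j - acc_rate \<nu> m * corr s run_dir * gram X j run_dir"
  by (rule corr_add[OF fit_in_run])

lemma corr_dir_in_run: "m \<le> run_len \<Longrightarrow> corr (s + m) run_dir = corr s run_dir * (1 - \<nu>) ^ m"
  unfolding corr_in_run by (simp add: gram_self acc_rate_def algebra_simps)

text \<open>Up to the end of the run, the hypothetical correlations in the switch time criterion are
  the actual ones of the algorithm.\<close>

lemma switch_time_le_iff_in_run:
  assumes "m \<le> run_len"
  shows "switch_time \<nu> X run_dir (corr s) j \<le> ereal (real m) \<longleftrightarrow>
    \<bar>corr (s + m) run_dir\<bar> < \<bar>corr (s + m) j\<bar>"
proof -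
  have "\<bar>corr (s + m) run_dir\<bar> = \<bar>corr s run_dir\<bar> * (1 - \<nu>) ^ m"
    using nu by (simp add: corr_dir_in_run[OF assms] abs_mult)
  then show ?thesis
    using switch_time_le_iff[of \<nu> "corr s" run_dir j X m] nu corr_dir_nonzero[of s]
      abs_corr_le[of s j] abs_gram_le_1[of j run_dir] corr_in_run[OF assms, of j]
    unfolding run_dir_def by metis
qed

text \<open>The last step of the run is still taken along \<open>run_dir\<close>, so just before it
  nobody has overtaken \<open>run_dir\<close>, and every switch time exceeds
  \<open>run_len - 1\<close>. Integrality raises this bound to \<open>run_len\<close>.\<close>

lemma switch_time_ge_run_length: "ereal (real run_len) \<le> switch_time \<nu> X run_dir (corr s) j"
  and switch_time_eq_run_length_iff:
    "switch_time \<nu> X run_dir (corr s) j = ereal (real run_len) \<longleftrightarrow>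
      \<bar>corr (s + run_len) run_dir\<bar> < \<bar>corr (s + run_len) j\<bar>"
proof -
  obtain m where m: "run_len = Suc m"
    using run_len_pos by (auto simp: gr0_conv_Suc)
  then have "k (Suc (s + m)) = run_dir"
    by (intro dir_in_run) auto
  then have "\<not> \<bar>corr (s + m) run_dir\<bar> < \<bar>corr (s + m) j\<bar>"
    using abs_corr_le[of "s + m" j] by simp
  then have "\<not> switch_time \<nu> X run_dir (corr s) j \<le> ereal (real m)"
    using switch_time_le_iff_in_run[of m j] m by simp
  then show ge: "ereal (real run_len) \<le> switch_time \<nu> X run_dir (corr s) j"
    using switch_time_eqI[of \<nu> X run_dir "corr s" j m] m by (metis linear)
  show "switch_time \<nu> X run_dir (corr s) j = ereal (real run_len) \<longleftrightarrow>
      \<bar>corr (s + run_len) run_dir\<bar> < \<bar>corr (s + run_len) j\<bar>"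
    using ge switch_time_le_iff_in_run[of run_len j] by (auto intro: antisym)
qed

text \<open>This is where the tie rule enters: a current direction that still attained the maximum
  would be kept, and the run would be longer. Hence a switch requires a strictly larger
  competitor.\<close>

lemma not_in_argmax_after_run: "run_dir \<notin> argmax_on UNIV (\<lambda>j. \<bar>corr (s + run_len) j\<bar>)"
proof
  assume "run_dir \<in> argmax_on UNIV (\<lambda>j. \<bar>corr (s + run_len) j\<bar>)"
  then have "k (Suc (s + run_len)) = run_dir"
    using run_len_pos dir_in_run[of "s + run_len"] by (simp add: dir_Suc)
  with dir_after_run_neq show False
    by contradiction
qed

lemma overtaken_after_run: obtains j where "\<bar>corr (s + run_len) run_dir\<bar> < \<bar>corr (s + run_len) j\<bar>"
  using not_in_argmax_after_run by (auto simp: mem_argmax_on not_le)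

lemma dir_after_run: "k (Suc (s + run_len)) = sel (argmax_on UNIV (\<lambda>j. \<bar>corr (s + run_len) j\<bar>))"
  using not_in_argmax_after_run run_len_pos dir_in_run[of "s + run_len"] by (simp add: dir_Suc)

lemma switch_time_dir_after_run:
  "switch_time \<nu> X run_dir (corr s) (k (Suc (s + run_len))) = ereal (real run_len)"
proof -
  obtain j where "\<bar>corr (s + run_len) run_dir\<bar> < \<bar>corr (s + run_len) j\<bar>"
    by (rule overtaken_after_run)
  with abs_corr_le[of "s + run_len" j] show ?thesis
    by (simp add: switch_time_eq_run_length_iff)
qed

text \<open>Every switch time is at least \<open>run_len\<close>, with equality exactly for the
  overtaking coordinates, of which there is at least one. Moreover \<open>run_dir\<close> cannot
  overtake itself, so the right-hand set respects the constraint.\<close>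

lemma arg_min_switch_time:
  "{j. is_arg_min (switch_time \<nu> X run_dir (corr s)) (\<lambda>j. j \<noteq> run_dir) j} =
    {j. \<bar>corr (s + run_len) run_dir\<bar> < \<bar>corr (s + run_len) j\<bar>}"
proof -
  obtain i where i: "\<bar>corr (s + run_len) run_dir\<bar> < \<bar>corr (s + run_len) i\<bar>"
    by (rule overtaken_after_run)
  then have "i \<noteq> run_dir" "switch_time \<nu> X run_dir (corr s) i = ereal (real run_len)"
    by (auto simp: switch_time_eq_run_length_iff)
  with switch_time_ge_run_length show ?thesis
    by (auto simp: is_arg_min_def not_less simp flip: switch_time_eq_run_length_iff)
      (metis antisym, metis order_less_irrefl switch_time_eq_run_length_iff)
qed

lemma dir_after_run_arg_min:
  "k (Suc (s + run_len)) =
    sel (argmax_on {j. is_arg_min (switch_time \<nu> X run_dir (corr s)) (\<lambda>j. j \<noteq> run_dir) j}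
      (\<lambda>j. \<bar>corr (s + run_len) j\<bar>))"
proof -
  obtain i where i: "\<bar>corr (s + run_len) run_dir\<bar> < \<bar>corr (s + run_len) i\<bar>"
    by (rule overtaken_after_run)
  show ?thesis
    unfolding dir_after_run arg_min_switch_time
    by (subst argmax_on_superlevel[where f = "\<lambda>j. \<bar>corr (s + run_len) j\<bar>", OF _ i]) auto
qed

lemma dir_after_run_Compl:
  "k (Suc (s + run_len)) = sel (argmax_on (- {run_dir}) (\<lambda>j. \<bar>corr (s + run_len) j\<bar>))"
proof -
  obtain i where i: "\<bar>corr (s + run_len) run_dir\<bar> < \<bar>corr (s + run_len) i\<bar>"
    by (rule overtaken_after_run)
  show ?thesis
    unfolding dir_after_run
    by (subst argmax_on_superlevel[where f = "\<lambda>j. \<bar>corr (s + run_len) j\<bar>", OF _ i]) auto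
qed

lemma run_length_eq_Min:
  "ereal (real run_len) = (MIN j\<in>- {run_dir}. switch_time \<nu> X run_dir (corr s) j)"
proof -
  have "ereal (real run_len) \<in> switch_time \<nu> X run_dir (corr s) ` (- {run_dir})"
    using dir_after_run_neq switch_time_dir_after_run by (metis Compl_iff imageI singletonD)
  then show ?thesis
    using switch_time_ge_run_length by (intro Min_eqI[symmetric]) auto
qed

end

end

section \<open>The recursion determines its sequences\<close>

lemma critical_recursion_unique:
  fixes X :: "real^'p^'n"
  assumes card: "CARD('p) \<ge> 2" and sel: "\<And>A. A \<noteq> {} \<Longrightarrow> sel A \<in> A"
    and rec: "critical_recursion sel \<nu> X y N l L S \<rho>"
    and rec': "critical_recursion sel \<nu> X y N l' L' S' \<rho>'"
  shows "(\<forall>r\<in>{1..N}. l' r = l r \<and> L' r = L r \<and> S' r = S r \<and> \<rho>' r = \<rho> r) \<and>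
    l' (N + 1) = l (N + 1) \<and> \<rho>' (N + 1) = \<rho> (N + 1)"
proof -
  \<comment> \<open>With at least two coordinates, the finite set of candidates other than
    \<open>a\<close> is nonempty, so minimizers exist and \<open>sel\<close> returns one of them,
    whatever \<open>f\<close> ranks them by.\<close>
  have arg_min: "is_arg_min (switch_time \<nu> X a \<sigma>) (\<lambda>j. j \<noteq> a) b"
    if "b = sel (argmax_on {j. is_arg_min (switch_time \<nu> X a \<sigma>) (\<lambda>j. j \<noteq> a) j} f)"
    for a b :: 'p and \<sigma> f
  proof -
    let ?B = "{j. is_arg_min (switch_time \<nu> X a \<sigma>) (\<lambda>j. j \<noteq> a) j}"
    have "- {a} \<noteq> {}"
      using card by (metis Compl_empty_eq double_complement numeral_le_one_iff
          semiring_norm(69) is_singletonI is_singleton_altdef)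
    then have "?B \<noteq> {}"
      using ex_is_arg_min_if_finite[of "- {a}" "switch_time \<nu> X a \<sigma>"] by simp
    then show ?thesis
      using sel[OF argmax_on_nonempty[of ?B f]] that by (simp add: mem_argmax_on)
  qed
  have base: "S 0 = 0" "S' 0 = 0" "\<rho>' 1 = \<rho> 1"
    using rec rec' by (auto simp: critical_recursion_def fun_eq_iff)
  then have base_l: "l' 1 = l 1"
    using rec rec' by (simp add: critical_recursion_def)
  have step: "L' r = L r \<and> S' r = S r \<and> l' (r + 1) = l (r + 1) \<and> \<rho>' (r + 1) = \<rho> (r + 1)"
    if r: "r \<in> {1..N}" and eq: "S' (r - 1) = S (r - 1)" "l' r = l r" "\<rho>' r = \<rho> r" for r
  proof -
    let ?st = "switch_time \<nu> X (l r) (\<rho> r)"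
    note unfolded = rec[unfolded critical_recursion_def] rec'[unfolded critical_recursion_def]
    have L: "ereal (real (L r)) = ?st (l (r + 1))" "ereal (real (L' r)) = ?st (l' (r + 1))"
      using unfolded r eq by auto
    have "is_arg_min ?st (\<lambda>j. j \<noteq> l r) (l (r + 1))" "is_arg_min ?st (\<lambda>j. j \<noteq> l r) (l' (r + 1))"
      using unfolded r eq by (auto intro!: arg_min)
    then have "?st (l (r + 1)) = ?st (l' (r + 1))"
      by (auto simp: is_arg_min_linorder intro: antisym)
    \<comment> \<open>\<open>l (r + 1)\<close> depends on \<open>L r\<close> through \<open>\<rho> (r + 1)\<close>, but the minimal switch time does not.\<close>
    with L have L: "L' r = L r"
      by (metis ereal.inject of_nat_eq_iff)
    moreover have "S' r = S r"
      using unfolded r eq L by auto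
    moreover have \<rho>: "\<rho>' (r + 1) = \<rho> (r + 1)"
      using unfolded r eq L by (auto simp: fun_eq_iff)
    moreover have "l' (r + 1) = l (r + 1)"
      using unfolded r eq \<rho> by auto
    ultimately show ?thesis by blast
  qed
  \<comment> \<open>The claim for \<open>r\<close> speaks of \<open>l\<close> and
    \<open>\<rho>\<close> at \<open>r + 1\<close>: thus \<open>r = 0\<close> is the initialization
    and \<open>r = N\<close> covers the values produced by the last round.\<close>
  have all: "S' r = S r \<and> l' (r + 1) = l (r + 1) \<and> \<rho>' (r + 1) = \<rho> (r + 1)" if "r \<le> N" for r
    using that
  proof (induction r)
    case 0
    then show ?case using base base_l by simp
  next
    case (Suc r)
    then show ?case using step[of "Suc r"] by simp
  qed
  show ?thesis
  proof (intro conjI ballI)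
    fix r assume r: "r \<in> {1..N}"
    then have *: "S' (r - 1) = S (r - 1)" "l' r = l r" "\<rho>' r = \<rho> r"
      using all[of "r - 1"] by auto
    then show "l' r = l r" "\<rho>' r = \<rho> r" by auto
    show "L' r = L r" "S' r = S r"
      using step[OF r *] by auto
  qed (use all[of N] in auto)
qed

section \<open>Boosting as the solution of the recursion\<close>

theorem theorem3:
  fixes X :: "real^'p^'n" and y :: "real^'n" and \<nu> :: real
    and sel :: "'p set \<Rightarrow> 'p" and M :: nat
  defines "F \<equiv> boost_fit sel \<nu> X y"
    and "k \<equiv> boost_dir sel \<nu> X y"
  defines "l \<equiv> crit_dir k"
    and "L \<equiv> descent_length k"
    and "S \<equiv> crit_point k"
  defines "\<rho> \<equiv> \<lambda>r j. column j X \<bullet> (y - F (S (r - 1)))"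
  assumes "0 < \<nu>" and "\<nu> < 1" and "CARD('p) \<ge> 2"
    and "(\<Sum>i\<in>UNIV. y $ i) = 0"
    and "\<forall>j. (\<Sum>i\<in>UNIV. X $ i $ j) = 0"
    and "\<forall>j. (\<Sum>i\<in>UNIV. (X $ i $ j)\<^sup>2) = 1"
    and "\<exists>j. column j X \<bullet> y \<noteq> 0"
    and "\<forall>A. A \<noteq> {} \<longrightarrow> sel A \<in> A"
    and "\<forall>r\<in>{1..M}. finite (descent k r)"
  shows
    "(\<forall>r\<in>{1..M}.
        F (S r) = F (S (r - 1)) + (acc_rate \<nu> (L r) * \<rho> r (l r)) *\<^sub>R column (l r) X) \<and>
     critical_recursion sel \<nu> X y M l L S \<rho> \<and>
     (\<forall>l' L' S' \<rho>'. critical_recursion sel \<nu> X y M l' L' S' \<rho>' \<longrightarrow>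
        (\<forall>r\<in>{1..M}. l' r = l r \<and> L' r = L r \<and> S' r = S r \<and> \<rho>' r = \<rho> r) \<and>
        l' (M + 1) = l (M + 1) \<and> \<rho>' (M + 1) = \<rho> (M + 1)) \<and>
     (\<forall>r\<in>{1..M}.
        ereal (real (L r)) = (MIN j\<in>- {l r}. switch_time \<nu> X (l r) (\<rho> r) j) \<and>
        l (r + 1) = sel (argmax_on (- {l r}) (\<lambda>j. \<bar>\<rho> (r + 1) j\<bar>)))"
proof -
  interpret l2_boosting X y \<nu> sel
    using assms by unfold_locales auto
  have \<rho>: "\<rho> r = corr (S (r - 1))" for r
    by (simp add: fun_eq_iff \<rho>_def F_def corr_def)
  have base: "S 0 = 0" "l 1 = sel (argmax_on UNIV (\<lambda>j. \<bar>\<rho> 1 j\<bar>))" "\<rho> 1 j = column j X \<bullet> (y - 0)" for j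
    by (simp_all add: S_def l_def crit_dir_def k_def dir_Suc \<rho> corr_def)
  have run: "F (S r) = F (S (r - 1)) + (acc_rate \<nu> (L r) * \<rho> r (l r)) *\<^sub>R column (l r) X"
      "S r = S (r - 1) + L r"
      "\<rho> (r + 1) j = \<rho> r j - acc_rate \<nu> (L r) * \<rho> r (l r) * gram X j (l r)"
      "ereal (real (L r)) = switch_time \<nu> X (l r) (\<rho> r) (l (r + 1))"
      "l (r + 1) = sel (argmax_on {j. is_arg_min (switch_time \<nu> X (l r) (\<rho> r)) (\<lambda>j. j \<noteq> l r) j}
         (\<lambda>j. \<bar>\<rho> (r + 1) j\<bar>))"
      "ereal (real (L r)) = (MIN j\<in>- {l r}. switch_time \<nu> X (l r) (\<rho> r) j)"
      "l (r + 1) = sel (argmax_on (- {l r}) (\<lambda>j. \<bar>\<rho> (r + 1) j\<bar>))"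
    if r: "r \<in> {1..M}" for r j
  proof -
    \<comment> \<open>The \<open>r\<close>-th descent is the run beginning after
      \<open>S (r - 1)\<close>, so all claims of round \<open>r\<close> are facts about the single
      run at this \<open>s\<close>.\<close>
    define s where "s = S (r - 1)"
    obtain r' where r': "r = Suc r'"
      using r by (cases r) auto
    have fin: "finite (run_from (boost_dir sel \<nu> X y) s)"
      using assms r by (simp add: descent_def s_def)
    have L: "L r = run_len s"
      unfolding run_len_def[OF fin] by (simp add: L_def descent_length_def descent_def s_def S_def k_def)
    have S: "S r = s + run_len s"
      unfolding run_len_def[OF fin] by (simp add: r' s_def S_def k_def)
    have "l (r + 1) = boost_dir sel \<nu> X y (Suc (S r))"
      by (simp add: l_def crit_dir_def S_def k_def)
    moreover have "l r = run_dir s"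
      unfolding run_dir_def[OF fin] by (simp add: l_def crit_dir_def s_def S_def k_def)
    ultimately have l: "l r = run_dir s" "l (r + 1) = boost_dir sel \<nu> X y (Suc (s + run_len s))"
      by (simp_all only: S)
    have \<rho>_eq: "\<rho> r = corr s" "\<rho> (r + 1) = corr (s + run_len s)"
      using S by (simp_all add: \<rho> s_def)
    note eqs = L l \<rho>_eq S s_def[symmetric] F_def
    show "F (S r) = F (S (r - 1)) + (acc_rate \<nu> (L r) * \<rho> r (l r)) *\<^sub>R column (l r) X"
      unfolding eqs by (rule fit_in_run[OF fin order_refl])
    show "S r = S (r - 1) + L r"
      unfolding eqs ..
    show "\<rho> (r + 1) j = \<rho> r j - acc_rate \<nu> (L r) * \<rho> r (l r) * gram X j (l r)"
      unfolding eqs by (rule corr_in_run[OF fin order_refl])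
    show "ereal (real (L r)) = switch_time \<nu> X (l r) (\<rho> r) (l (r + 1))"
      unfolding eqs by (rule switch_time_dir_after_run[OF fin, symmetric])
    show "l (r + 1) = sel (argmax_on {j. is_arg_min (switch_time \<nu> X (l r) (\<rho> r)) (\<lambda>j. j \<noteq> l r) j}
         (\<lambda>j. \<bar>\<rho> (r + 1) j\<bar>))"
      unfolding eqs by (rule dir_after_run_arg_min[OF fin])
    show "ereal (real (L r)) = (MIN j\<in>- {l r}. switch_time \<nu> X (l r) (\<rho> r) j)"
      unfolding eqs by (rule run_length_eq_Min[OF fin])
    show "l (r + 1) = sel (argmax_on (- {l r}) (\<lambda>j. \<bar>\<rho> (r + 1) j\<bar>))"
      unfolding eqs by (rule dir_after_run_Compl[OF fin])
  qed
  have rec: "critical_recursion sel \<nu> X y M l L S \<rho>"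
    unfolding critical_recursion_def using base run(2-5) by blast
  moreover note critical_recursion_unique[OF \<open>CARD('p) \<ge> 2\<close> sel rec]
  ultimately show ?thesis
    using run(1,6,7) by blast
qed

end
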